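(* Let $m\ge 2$ be an integer and $B_m=\{a^i \mid i\equiv 0 \pmod m\}\subseteq\{a\}^*$. For every $\epsilon>0$ there exists a one-way quantum finite automaton with restart $\mathcal{M}_{m,\epsilon}$ with exactly 7 states which accepts every $w\in B_m$ with probability 1 and rejects every $w\in\{a\}^*\setminus B_m$ with probability at least $1-\epsilon$. Moreover, the expected runtime of $\mathcal{M}_{m,\epsilon}$ on input $w$ is $O\big(\frac{1}{\epsilon}\sin^{-2}(\frac{\pi}{m})|w|\big)$.
   Context: Let $\vdash,\dashv$ be left and right end-markers not in the input alphabet $\Sigma$ (here $\Sigma=\{a\}$), and $\Gamma=\Sigma\cup\{\vdash,\dashv\}$. A one-way quantum finite automaton with restart over $\Sigma$ consists of a finite state set $Q$ partitioned into disjoint sets $Q_{non}$ (nonhalting), $Q_{acc}$ (accepting), $Q_{rej}$ (rejecting), $Q_{restart}$ (restarting), an initial state $q_0\in Q_{non}$, and for each $\sigma\in\Gamma$ a unitary operator $U_\sigma$ on the Hilbert space with orthonormal basis $\{|q\rangle:q\in Q\}$. On input $w$ the tape contains $\vdash w\dashv$. A round starts in $|q_0\rangle$ with the head on $\vdash$; symbols are read left to right; on each symbol $\sigma$ the machine applies $U_\sigma$ and then performs the projective measurement onto the spans of $Q_{acc},Q_{rej},Q_{non},Q_{restart}$: "accept"/"reject" halt with that answer, "nonhalting" continues with the normalized projection onto the span of $Q_{non}$ on the next symbol, "restart" begins a new round from $|q_0\rangle$ with head on $\vdash$. Each round ends in halting or restarting with probability 1. Acceptance/rejection probabilities are those of eventually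 accepting/rejecting over all rounds; runtime counts all steps of all rounds; the number of states is $|Q|$. *)

theory Defs
  imports "HOL-Probability.Probability" "HOL-Number_Theory.Cong"
begin

datatype 'a tape_symbol = LeftEnd | Input 'a | RightEnd

definition tape :: "'a list \<Rightarrow> 'a tape_symbol list" where
  "tape w = LeftEnd # map Input w @ [RightEnd]"

definition adjoint_matrix :: "complex^'n^'m \<Rightarrow> complex^'m^'n" where
  "adjoint_matrix U = (\<chi> i j. cnj (U $ j $ i))"

definition unitary_matrix :: "complex^'n^'n \<Rightarrow> bool" where
  "unitary_matrix U \<longleftrightarrow>
     adjoint_matrix U ** U = mat 1 \<and> U ** adjoint_matrix U = mat 1"

text \<open>The state set is the finite type \<open>'q\<close>; the Hilbert space with orthonormal basis
  \<open>'q\<close> is \<open>complex^'q\<close>, with basis vectors \<open>axis q 1\<close>. The entry \<open>U $ p $ q\<close> of the transition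
  matrix is the amplitude of going from \<open>q\<close> to \<open>p\<close>.\<close>

record ('q, 'a) rqfa =
  q_non :: "'q set"
  q_acc :: "'q set"
  q_rej :: "'q set"
  q_restart :: "'q set"
  q_init :: 'q
  transition :: "'a tape_symbol \<Rightarrow> complex^'q^'q"

definition rqfa_states :: "('q::finite, 'a) rqfa \<Rightarrow> 'q set" where
  "rqfa_states M = q_non M \<union> q_acc M \<union> q_rej M \<union> q_restart M"

datatype outcome = Nonhalt | Accept | Reject | Restart

fun outcome_states :: "('q::finite, 'a) rqfa \<Rightarrow> outcome \<Rightarrow> 'q set" where
  "outcome_states M Nonhalt = q_non M"
| "outcome_states M Accept = q_acc M"
| "outcome_states M Reject = q_rej M"
| "outcome_states M Restart = q_restart M"

definition span_proj :: "'q::finite set \<Rightarrow> complex^'q \<Rightarrow> complex^'q" where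
  "span_proj S \<psi> = (\<chi> q. if q \<in> S then \<psi> $ q else 0)"

text \<open>On a unit vector, and for a partition of the states, the weights below sum to 1, so that
  they are the probabilities of the resulting distribution.\<close>

definition measurement :: "('q::finite, 'a) rqfa \<Rightarrow> complex^'q \<Rightarrow> outcome pmf" where
  "measurement M \<psi> = embed_pmf (\<lambda>x. (norm (span_proj (outcome_states M x) \<psi>))\<^sup>2)"

text \<open>A running configuration consists of the current unit vector and the part of the tape that
  is still to be read in the current round.\<close>

datatype ('q, 'a) config = Running "complex^'q" "'a tape_symbol list" | Accepted | Rejected

definition start_config :: "('q::finite, 'a) rqfa \<Rightarrow> 'a list \<Rightarrow> ('q, 'a) config" where
  "start_config M w = Running (axis (q_init M) 1) (tape w)"

text \<open>\<open>sgn\<close> is normalization. The automaton predicate \<open>is_rqfa\<close> below excludes that a running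
  configuration with empty remaining tape is ever reached.\<close>

fun config_after ::
    "('q::finite, 'a) rqfa \<Rightarrow> 'a list \<Rightarrow> complex^'q \<Rightarrow> 'a tape_symbol list \<Rightarrow> outcome \<Rightarrow> ('q, 'a) config"
where
  "config_after M w \<phi> xs Nonhalt = Running (sgn (span_proj (q_non M) \<phi>)) xs"
| "config_after M w \<phi> xs Accept = Accepted"
| "config_after M w \<phi> xs Reject = Rejected"
| "config_after M w \<phi> xs Restart = start_config M w"

text \<open>The second component counts the steps performed so far, over all rounds.\<close>

fun step :: "('q::finite, 'a) rqfa \<Rightarrow> 'a list \<Rightarrow> ('q, 'a) config \<times> nat \<Rightarrow> (('q, 'a) config \<times> nat) pmf"
where
  "step M w (Running \<psi> (\<sigma> # xs), t) =
     (let \<phi> = transition M \<sigma> *v \<psi>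
      in map_pmf (\<lambda>x. (config_after M w \<phi> xs x, Suc t)) (measurement M \<phi>))"
| "step M w (Running \<psi> [], t) = return_pmf (Running \<psi> [], t)"
| "step M w (Accepted, t) = return_pmf (Accepted, t)"
| "step M w (Rejected, t) = return_pmf (Rejected, t)"

primrec run :: "('q::finite, 'a) rqfa \<Rightarrow> 'a list \<Rightarrow> nat \<Rightarrow> (('q, 'a) config \<times> nat) pmf" where
  "run M w 0 = return_pmf (start_config M w, 0)"
| "run M w (Suc k) = bind_pmf (run M w k) (step M w)"

text \<open>The last clause says that every round ends in halting or restarting with probability 1:
  no round survives reading the right end-marker.\<close>

definition is_rqfa :: "('q::finite, 'a) rqfa \<Rightarrow> bool" where
  "is_rqfa M \<longleftrightarrow>
     rqfa_states M = UNIV \<and>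
     (\<forall>x y. x \<noteq> y \<longrightarrow> outcome_states M x \<inter> outcome_states M y = {}) \<and>
     q_init M \<in> q_non M \<and>
     (\<forall>\<sigma>. unitary_matrix (transition M \<sigma>)) \<and>
     (\<forall>w k \<psi> t. (Running \<psi> [], t) \<notin> set_pmf (run M w k))"

text \<open>Accepted and rejected configurations are absorbing and the step counter never decreases,
  so each supremum is the limit as the number of time units \<open>k\<close> tends to infinity; for the
  expectation this is monotone convergence, with value \<open>\<infinity>\<close> allowed.\<close>

definition accept_prob :: "('q::finite, 'a) rqfa \<Rightarrow> 'a list \<Rightarrow> real" where
  "accept_prob M w = (SUP k. measure_pmf.prob (run M w k) {c. fst c = Accepted})"

definition reject_prob :: "('q::finite, 'a) rqfa \<Rightarrow> 'a list \<Rightarrow> real" where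
  "reject_prob M w = (SUP k. measure_pmf.prob (run M w k) {c. fst c = Rejected})"

definition expected_runtime :: "('q::finite, 'a) rqfa \<Rightarrow> 'a list \<Rightarrow> ennreal" where
  "expected_runtime M w = (SUP k. \<integral>\<^sup>+ c. of_nat (snd c) \<partial>measure_pmf (run M w k))"

text \<open>The one-letter alphabet; the set of all words over it is \<open>UNIV\<close>.\<close>

datatype letter = Letter_a

definition B :: "nat \<Rightarrow> letter list set" where
  "B m = {replicate i Letter_a | i. [i = 0] (mod m)}"

end

theory Submission
  imports Defs
begin

text \<open>Three nonhalting states carry the computation. On the left end-marker a rotation by \<open>\<theta>\<close> puts
  amplitude \<open>sin \<theta>\<close> on the third of them, where it stays; the first two form a plane which every
  letter rotates by \<open>\<pi>/m\<close>. The right end-marker sends the first two to a restarting and a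
  rejecting state, the third to an accepting state, so that a round on \<open>a\<^sup>n\<close> accepts with
  probability \<open>sin\<^sup>2 \<theta>\<close> and rejects with probability \<open>cos\<^sup>2 \<theta> sin\<^sup>2(n\<pi>/m)\<close>. The latter vanishes if
  \<open>m\<close> divides \<open>n\<close> and is at least \<open>cos\<^sup>2 \<theta> sin\<^sup>2(\<pi>/m)\<close> otherwise, so \<open>sin\<^sup>2 \<theta> = min(1, \<epsilon>) sin\<^sup>2(\<pi>/m) / 2\<close>
  works.\<close>

section \<open>Iterating rounds\<close>

lemma UNIV_outcome: "(UNIV :: outcome set) = {Nonhalt, Accept, Reject, Restart}"
  by (auto intro: outcome.exhaust)

text \<open>\<open>embed_pmf\<close> has the prescribed weights once they are nonnegative and sum to
  1; the hypothesis supplies the sum.\<close>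

lemma pmf_measurement:
  assumes "(\<Sum>x\<in>UNIV. (norm (span_proj (outcome_states M x) \<psi>))\<^sup>2) = 1"
  shows "pmf (measurement M \<psi>) x = (norm (span_proj (outcome_states M x) \<psi>))\<^sup>2"
  unfolding measurement_def
proof (rule pmf_embed_pmf)
  have "finite (UNIV :: outcome set)" by (simp add: UNIV_outcome)
  then show "(\<integral>\<^sup>+ x. ennreal ((norm (span_proj (outcome_states M x) \<psi>))\<^sup>2) \<partial>count_space UNIV) = 1"
    using assms by (simp add: nn_integral_count_space_finite sum_ennreal)
qed simp

lemma nn_integral_outcome_pmf:
  fixes p :: "outcome pmf"
  shows "(\<integral>\<^sup>+ x. f x \<partial>measure_pmf p) =
    f Nonhalt * pmf p Nonhalt + f Accept * pmf p Accept + f Reject * pmf p Reject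
      + f Restart * pmf p Restart"
proof -
  have "finite (UNIV :: outcome set)" by (simp add: UNIV_outcome)
  then have "finite (set_pmf p)" by (rule finite_subset[rotated]) simp
  then have "(\<integral>\<^sup>+ x. f x \<partial>measure_pmf p) = (\<Sum>x\<in>set_pmf p. f x * pmf p x)"
    by (rule nn_integral_measure_pmf_finite) simp
  also have "\<dots> = (\<Sum>x\<in>UNIV. f x * pmf p x)"
    using \<open>finite UNIV\<close> by (intro sum.mono_neutral_left) (auto simp: set_pmf_iff)
  finally show ?thesis by (simp add: UNIV_outcome add.assoc)
qed

lemma sum_pmf_outcome:
  "pmf p Nonhalt + pmf p Accept + pmf p Reject + pmf p Restart = 1"
proof -
  have "finite (UNIV :: outcome set)" by (simp add: UNIV_outcome)
  then have "(\<Sum>x\<in>UNIV. pmf p x) = 1" by (rule sum_pmf_eq_1) simp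
  then show ?thesis by (simp add: UNIV_outcome add.assoc)
qed

text \<open>Every measurement before the right end-marker gives \<open>Nonhalt\<close> surely, so a
  round is a deterministic path with a single random outcome at its end: accept with probability
  \<open>a\<close>, reject with \<open>r\<close>, restart otherwise. Positivity of
  \<open>a + r\<close> makes the number of rounds geometric.\<close>

locale measurement_free_round =
  fixes M :: "('q::finite, 'a) rqfa" and w :: "'a list" and \<psi> :: "nat \<Rightarrow> complex^'q"
    and a r :: real
  assumes initial: "\<psi> 0 = axis (q_init M) 1"
    and nonhalt: "\<And>j. j \<le> length w \<Longrightarrow>
      measurement M (transition M (tape w ! j) *v \<psi> j) = return_pmf Nonhalt"
    and evolve: "\<And>j. j \<le> length w \<Longrightarrow>
      sgn (span_proj (q_non M) (transition M (tape w ! j) *v \<psi> j)) = \<psi> (Suc j)"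
    and end_nonhalt: "pmf (measurement M (transition M RightEnd *v \<psi> (Suc (length w)))) Nonhalt = 0"
    and end_accept: "pmf (measurement M (transition M RightEnd *v \<psi> (Suc (length w)))) Accept = a"
    and end_reject: "pmf (measurement M (transition M RightEnd *v \<psi> (Suc (length w)))) Reject = r"
    and halting: "a + r > 0"
begin

section \<open>Configurations that can occur\<close>

lemma a_nonneg: "a \<ge> 0" and r_nonneg: "r \<ge> 0"
  using end_accept end_reject pmf_nonneg by metis+

lemma end_restart:
  "pmf (measurement M (transition M RightEnd *v \<psi> (Suc (length w)))) Restart = 1 - a - r"
  using sum_pmf_outcome[of "measurement M (transition M RightEnd *v \<psi> (Suc (length w)))"]
    end_nonhalt end_accept end_reject by simp

lemma a_plus_r_le_1: "a + r \<le> 1"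
  using pmf_nonneg[of "measurement M (transition M RightEnd *v \<psi> (Suc (length w)))" Restart]
  by (simp add: end_restart)

abbreviation (input) config_at :: "nat \<Rightarrow> ('q, 'a) config" where
  "config_at j \<equiv> Running (\<psi> j) (drop j (tape w))"

text \<open>A superset of the support of \<open>run M w k\<close>. Each time unit is one step, so a
  running configuration carries the counter \<open>k\<close> itself; halting freezes the counter,
  which is therefore left free.\<close>

definition on_track :: "nat \<Rightarrow> (('q, 'a) config \<times> nat) set" where
  "on_track k = {(config_at j, k) | j. j \<le> Suc (length w)} \<union> {Accepted, Rejected} \<times> UNIV"

lemma on_track_cases [consumes 1, case_names inner last accepted rejected]:
  assumes "c \<in> on_track k"
  obtains j where "j \<le> length w" "c = (config_at j, k)"
  | "c = (config_at (Suc (length w)), k)"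
  | t where "c = (Accepted, t)"
  | t where "c = (Rejected, t)"
  using assms unfolding on_track_def by (auto simp: le_Suc_eq)

lemma step_nonhalt:
  assumes "j \<le> length w"
  shows "step M w (config_at j, t) = return_pmf (config_at (Suc j), Suc t)"
proof -
  have "drop j (tape w) = tape w ! j # drop (Suc j) (tape w)"
    using assms by (intro Cons_nth_drop_Suc[symmetric]) (simp add: tape_def)
  then show ?thesis using nonhalt[OF assms] evolve[OF assms] by (simp add: Let_def)
qed

lemma step_end:
  "step M w (config_at (Suc (length w)), t) =
    map_pmf (\<lambda>x. (config_after M w (transition M RightEnd *v \<psi> (Suc (length w))) [] x, Suc t))
      (measurement M (transition M RightEnd *v \<psi> (Suc (length w))))"
  by (simp add: tape_def Let_def)

lemma start_config_eq: "start_config M w = config_at 0"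
  by (simp add: start_config_def initial)

text \<open>Only \<open>Nonhalt\<close> on the right end-marker could leave the set, and it has
  probability 0; a restart leads back to index 0.\<close>

lemma set_pmf_step:
  assumes "c \<in> on_track k"
  shows "set_pmf (step M w c) \<subseteq> on_track (Suc k)"
  using assms
proof (cases rule: on_track_cases)
  case (inner j)
  then show ?thesis by (auto simp: step_nonhalt on_track_def)
next
  case last
  have after: "(config_after M w \<phi> [] x, Suc k) \<in> on_track (Suc k)" if "x \<noteq> Nonhalt" for x \<phi>
    using that by (cases x) (auto simp: on_track_def start_config_eq)
  show ?thesis
    unfolding last step_end set_map_pmf
    using end_nonhalt by (intro image_subsetI after) (auto simp: set_pmf_iff)
qed (auto simp: on_track_def)

lemma set_pmf_run: "set_pmf (run M w k) \<subseteq> on_track k"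
proof (induction k)
  case 0
  then show ?case by (auto simp: on_track_def start_config_eq)
next
  case (Suc k)
  then show ?case using set_pmf_step by fastforce
qed

text \<open>The tape has \<open>length w + 2\<close> symbols and the indices stop at
  \<open>Suc (length w)\<close>, so at least one symbol is unread.\<close>

lemma no_survivor: "(Running \<phi> [], t) \<notin> set_pmf (run M w k)"
  using set_pmf_run[of k] by (auto simp: on_track_def tape_def)

section \<open>Martingales for the runtime and for absorption\<close>

lemma nn_integral_run_invariant:
  assumes "\<And>j t. j \<le> length w \<Longrightarrow> f (config_at (Suc j), Suc t) = f (config_at j, t)"
    and "\<And>t. f (config_at (Suc (length w)), t) =
      ennreal a * f (Accepted, Suc t) + ennreal r * f (Rejected, Suc t)
        + ennreal (1 - a - r) * f (config_at 0, Suc t)"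
  shows "(\<integral>\<^sup>+ c. f c \<partial>measure_pmf (run M w k)) = f (config_at 0, 0)"
proof (induction k)
  case 0
  then show ?case by (simp add: start_config_eq)
next
  case (Suc k)
  \<comment> \<open>\<open>f\<close> is harmonic for \<open>step\<close>: the hypotheses say so at
    running configurations, and halted ones are fixed points.\<close>
  have "(\<integral>\<^sup>+ c'. f c' \<partial>measure_pmf (step M w c)) = f c" if "c \<in> on_track k" for c
    using that
  proof (cases rule: on_track_cases)
    case (inner j)
    then show ?thesis by (simp add: step_nonhalt assms(1))
  next
    case last
    show ?thesis
      unfolding last step_end nn_integral_map_pmf nn_integral_outcome_pmf
        end_nonhalt end_accept end_reject end_restart assms(2)
      by (simp add: start_config_eq mult.commute)
  qed auto
  then have "(\<integral>\<^sup>+ c. f c \<partial>measure_pmf (run M w (Suc k))) = (\<integral>\<^sup>+ c. f c \<partial>measure_pmf (run M w k))"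
    using set_pmf_run by (auto simp: nn_integral_bind_pmf intro!: nn_integral_cong_AE AE_pmfI)
  then show ?case using Suc by simp
qed

text \<open>With \<open>L = (|w| + 2) / (a + r)\<close>, the elapsed time plus the potential \<open>L - j\<close> of the \<open>j\<close>-th
  configuration of a round is a martingale.\<close>

lemma nn_integral_time_le:
  "(\<integral>\<^sup>+ c. of_nat (snd c) \<partial>measure_pmf (run M w k)) \<le> ennreal ((real (length w) + 2) / (a + r))"
proof -
  \<comment> \<open>Each round takes \<open>length w + 2\<close> steps and halts with probability
    \<open>a + r\<close>, so \<open>L\<close> is the mean total time.\<close>
  define L where "L = (real (length w) + 2) / (a + r)"
  \<comment> \<open>At index \<open>j\<close> the unread tape has length
    \<open>length w + 2 - j\<close>, which makes the potential \<open>L - j\<close>.\<close>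
  define V :: "('q, 'a) config \<Rightarrow> real" where
    "V c = (case c of Running _ xs \<Rightarrow> L - (real (length w) + 2) + real (length xs) | _ \<Rightarrow> 0)" for c
  \<comment> \<open>This keeps the potential nonnegative, so that sums and products pass through
    \<open>ennreal\<close> intact.\<close>
  have L: "L \<ge> real (length w) + 2"
    using halting a_plus_r_le_1 by (simp add: L_def le_divide_eq mult_left_le)
  have L_eq: "(a + r) * L = real (length w) + 2"
    using halting by (simp add: L_def)
  have V_nonneg: "V c \<ge> 0" for c
    using L by (auto simp: V_def split: config.split)
  have "(\<integral>\<^sup>+ c. of_nat (snd c) \<partial>measure_pmf (run M w k))
      \<le> (\<integral>\<^sup>+ c. ennreal (real (snd c) + V (fst c)) \<partial>measure_pmf (run M w k))"
    using V_nonneg by (intro nn_integral_mono) (simp add: ennreal_of_nat_eq_real_of_nat ennreal_leI)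
  also have "\<dots> = ennreal (real (snd (config_at 0, 0::nat)) + V (fst (config_at 0, 0::nat)))"
  proof (rule nn_integral_run_invariant)
    show "ennreal (real (snd (config_at (Suc j), Suc t)) + V (fst (config_at (Suc j), Suc t)))
      = ennreal (real (snd (config_at j, t)) + V (fst (config_at j, t)))" if "j \<le> length w" for j t
      using that by (simp add: V_def tape_def of_nat_diff)
    show "ennreal (real (snd (config_at (Suc (length w)), t)) + V (fst (config_at (Suc (length w)), t)))
      = ennreal a * ennreal (real (snd (Accepted :: ('q,'a) config, Suc t)) + V (fst (Accepted, Suc t)))
        + ennreal r * ennreal (real (snd (Rejected :: ('q,'a) config, Suc t)) + V (fst (Rejected, Suc t)))
        + ennreal (1 - a - r) * ennreal (real (snd (config_at 0, Suc t)) + V (fst (config_at 0, Suc t)))"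
      for t
    proof -
      \<comment> \<open>The balance is \<open>L - (length w + 1) = 1 + (1 - a - r) * L\<close>, a
        rearrangement of \<open>L_eq\<close>.\<close>
      have "real t + V (config_at (Suc (length w)))
        = a * (real (Suc t)) + r * (real (Suc t)) + (1 - a - r) * (real (Suc t) + V (config_at 0))"
        using L_eq by (simp add: V_def tape_def algebra_simps)
      then show ?thesis
        using a_nonneg r_nonneg a_plus_r_le_1 V_nonneg
        by (simp add: V_def[of Accepted] V_def[of Rejected] flip: ennreal_mult ennreal_plus)
    qed
  qed
  also have "real (snd (config_at 0, 0::nat)) + V (fst (config_at 0, 0::nat)) = L"
    by (simp add: V_def tape_def)
  finally show ?thesis by (simp add: L_def)
qed

lemma expected_runtime_le:
  "expected_runtime M w \<le> ennreal ((real (length w) + 2) / (a + r))"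
  unfolding expected_runtime_def by (intro SUP_least nn_integral_time_le)

text \<open>A configuration that is still running after \<open>k\<close> time units has used all of them.\<close>

lemma prob_running_le:
  "real k * measure_pmf.prob (run M w k) {c. fst c \<notin> {Accepted, Rejected}}
    \<le> (real (length w) + 2) / (a + r)"
proof -
  let ?R = "{c :: ('q, 'a) config \<times> nat. fst c \<notin> {Accepted, Rejected}}"
  have "ennreal (real k * measure_pmf.prob (run M w k) ?R)
      = (\<integral>\<^sup>+ c. ennreal (real k) * indicator ?R c \<partial>measure_pmf (run M w k))"
    by (subst nn_integral_cmult_indicator)
      (auto simp: measure_pmf.emeasure_eq_measure ennreal_mult)
  also have "\<dots> \<le> (\<integral>\<^sup>+ c. of_nat (snd c) \<partial>measure_pmf (run M w k))"
    using set_pmf_run[of k]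
    by (intro nn_integral_mono_AE AE_pmfI)
      (auto simp: on_track_def ennreal_of_nat_eq_real_of_nat split: split_indicator)
  also note nn_integral_time_le
  finally show ?thesis
    using halting by (subst (asm) ennreal_le_iff) auto
qed

text \<open>\<open>b\<close> is the probability of \<open>H\<close> given that a round halts. Hence
  the function worth 1 at \<open>H\<close>, 0 at the other halted configuration and \<open>b\<close>
  while running is a martingale. So \<open>b\<close> exceeds the probability of \<open>H\<close>
  after \<open>k\<close> time units by at most that of still running, which is O(1/k).\<close>

lemma absorption_ge:
  assumes "0 \<le> b" "b \<le> 1"
    and "H \<in> {Accepted, Rejected}"
    and "(if H = Accepted then a else r) = b * (a + r)"
  shows "(SUP k. measure_pmf.prob (run M w k) {c. fst c = H}) \<ge> b"
proof -
  let ?R = "{c :: ('q, 'a) config \<times> nat. fst c \<notin> {Accepted, Rejected}}"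
  let ?H = "{c :: ('q, 'a) config \<times> nat. fst c = H}"
  define g :: "('q, 'a) config \<Rightarrow> real" where
    "g c = (if c \<in> {Accepted, Rejected} then (if c = H then 1 else 0) else b)" for c
  define L where "L = (real (length w) + 2) / (a + r)"
  have lower: "b \<le> measure_pmf.prob (run M w k) ?H + L / real k" if "k > 0" for k
  proof -
    have "(\<integral>\<^sup>+ c. ennreal (g (fst c)) \<partial>measure_pmf (run M w k))
        = ennreal (g (fst (config_at 0, 0::nat)))"
    proof (rule nn_integral_run_invariant)
      show "ennreal (g (fst (config_at (Suc (length w)), t)))
        = ennreal a * ennreal (g (fst (Accepted, Suc t))) + ennreal r * ennreal (g (fst (Rejected, Suc t)))
          + ennreal (1 - a - r) * ennreal (g (fst (config_at 0, Suc t)))" for t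
      proof -
        \<comment> \<open>The two halting terms together contribute
          \<open>b * (a + r)\<close>.\<close>
        have "b = a * g Accepted + r * g Rejected + (1 - a - r) * b"
          using assms(3,4) by (auto simp: g_def algebra_simps split: if_splits)
        then show ?thesis
          using a_nonneg r_nonneg a_plus_r_le_1 assms(1)
          by (simp add: g_def flip: ennreal_mult ennreal_plus)
      qed
    qed (simp add: g_def)
    then have "ennreal b = (\<integral>\<^sup>+ c. ennreal (g (fst c)) \<partial>measure_pmf (run M w k))"
      by (simp add: g_def)
    \<comment> \<open>Running configurations have the value \<open>b \<le> 1\<close>.\<close>
    also have "\<dots> \<le> (\<integral>\<^sup>+ c. indicator ?H c + indicator ?R c \<partial>measure_pmf (run M w k))"
      using assms(1-3) by (intro nn_integral_mono) (auto simp: g_def split: split_indicator)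
    also have "\<dots> = ennreal (measure_pmf.prob (run M w k) ?H + measure_pmf.prob (run M w k) ?R)"
      by (simp add: nn_integral_add measure_pmf.emeasure_eq_measure)
    finally have "b \<le> measure_pmf.prob (run M w k) ?H + measure_pmf.prob (run M w k) ?R"
      by (subst (asm) ennreal_le_iff) auto
    moreover have "measure_pmf.prob (run M w k) ?R \<le> L / real k"
      using prob_running_le[of k, folded L_def] that by (simp add: pos_le_divide_eq mult.commute)
    ultimately show ?thesis by linarith
  qed
  have bdd: "bdd_above (range (\<lambda>k. measure_pmf.prob (run M w k) ?H))"
    by (rule bdd_aboveI[of _ 1]) auto
  have "(\<lambda>k. (SUP k. measure_pmf.prob (run M w k) ?H) + L / real k)
      \<longlonglongrightarrow> (SUP k. measure_pmf.prob (run M w k) ?H) + 0"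
    by (intro tendsto_intros lim_const_over_n)
  then have "b \<le> (SUP k. measure_pmf.prob (run M w k) ?H) + 0"
  proof (rule LIMSEQ_le_const, intro exI[of _ 1] allI impI)
    show "b \<le> (SUP k. measure_pmf.prob (run M w k) ?H) + L / real k" if "1 \<le> k" for k
      using lower[of k] cSUP_upper[OF UNIV_I bdd, of k] that by linarith
  qed
  then show ?thesis by simp
qed

lemma accept_prob_ge: "accept_prob M w \<ge> a / (a + r)"
  unfolding accept_prob_def
  by (rule absorption_ge)
    (use halting a_nonneg r_nonneg in \<open>auto simp: divide_le_eq_1\<close>)

lemma reject_prob_ge: "reject_prob M w \<ge> r / (a + r)"
  unfolding reject_prob_def
  by (rule absorption_ge)
    (use halting a_nonneg r_nonneg in \<open>auto simp: divide_le_eq_1\<close>)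

end

lemma accept_prob_le_1: "accept_prob M w \<le> 1"
  unfolding accept_prob_def by (rule cSUP_least) auto

section \<open>Plane rotations\<close>

text \<open>The quarter turn \<open>t = pi / 2\<close> serves as a signed swap: it sends the basis
  vector of \<open>p\<close> to that of \<open>q\<close>, and that of \<open>q\<close> to minus that
  of \<open>p\<close>.\<close>

definition plane_rotation :: "'n::finite \<Rightarrow> 'n \<Rightarrow> real \<Rightarrow> complex^'n^'n" where
  "plane_rotation p q t = (\<chi> i j.
     if i = p then (if j = p then of_real (cos t) else if j = q then - of_real (sin t) else 0)
     else if i = q then (if j = p then of_real (sin t) else if j = q then of_real (cos t) else 0)
     else if i = j then 1 else 0)"

lemma plane_rotation_mult_vec:
  assumes "p \<noteq> q"
  shows "plane_rotation p q t *v x = (\<chi> i.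
     if i = p then of_real (cos t) * x $ p - of_real (sin t) * x $ q
     else if i = q then of_real (sin t) * x $ p + of_real (cos t) * x $ q
     else x $ i)"
proof -
  have two: "(\<Sum>j\<in>UNIV. (if j = p then c else if j = q then d else 0) * x $ j) = c * x $ p + d * x $ q"
    for c d
  proof -
    have "(\<Sum>j\<in>UNIV. (if j = p then c else if j = q then d else 0) * x $ j)
      = (\<Sum>j\<in>UNIV. (if j = p then c * x $ j else 0) + (if j = q then d * x $ j else 0))"
      using assms by (intro sum.cong) auto
    then show ?thesis by (simp add: sum.distrib)
  qed
  have "(\<Sum>j\<in>UNIV. (if i = j then 1 else 0) * x $ j) = x $ i" for i
    by (simp add: if_distrib[of "\<lambda>u. u * _"] cong: if_cong)
  then show ?thesis
    using assms two[of "of_real (cos t)" "- of_real (sin t)"] two[of "of_real (sin t)" "of_real (cos t)"]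
    by (simp add: vec_eq_iff plane_rotation_def matrix_vector_mult_def)
qed

lemma plane_rotation_inverse:
  assumes "p \<noteq> q"
  shows "plane_rotation p q (- t) ** plane_rotation p q t = mat 1"
proof -
  have eq: "complex_of_real (cos t) * (cos t) + complex_of_real (sin t) * (sin t) = 1"
    by (simp only: sin_cos_squared_add3 of_real_1 flip: of_real_mult of_real_add)
  \<comment> \<open>With cosine and sine abstracted to \<open>c\<close> and \<open>s\<close>,
    undoing a rotation is a polynomial identity modulo \<open>c * c + s * s = 1\<close>.\<close>
  have "c * (c * x - s * y) + s * (s * x + c * y) = x" "c * (s * x + c * y) - s * (c * x - s * y) = y"
    if "c * c + s * s = 1" for c s x y :: complex
    using that by algebra+
  note * = this[OF eq]
  show ?thesis
    unfolding matrix_eq matrix_vector_mul_assoc[symmetric] plane_rotation_mult_vec[OF assms]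
    using assms * by (simp add: vec_eq_iff)
qed

text \<open>The entries are real and transposing flips the sign of the sine, so the adjoint is the
  rotation by \<open>- t\<close>.\<close>

lemma unitary_plane_rotation:
  assumes "p \<noteq> q"
  shows "unitary_matrix (plane_rotation p q t)"
proof -
  have "adjoint_matrix (plane_rotation p q t) = plane_rotation p q (- t)"
    using assms by (auto simp: adjoint_matrix_def plane_rotation_def vec_eq_iff)
  then show ?thesis
    using plane_rotation_inverse[OF assms, of t] plane_rotation_inverse[OF assms, of "- t"]
    by (simp add: unitary_matrix_def)
qed

lemma adjoint_matrix_mult: "adjoint_matrix (V ** W) = adjoint_matrix W ** adjoint_matrix V"
  by (simp add: adjoint_matrix_def matrix_matrix_mult_def vec_eq_iff mult.commute)

lemma unitary_matrix_mult:
  assumes "unitary_matrix V" "unitary_matrix W"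
  shows "unitary_matrix (V ** W)"
proof -
  have "adjoint_matrix W ** (adjoint_matrix V ** V) ** W = mat 1"
    "V ** (W ** adjoint_matrix W) ** adjoint_matrix V = mat 1"
    using assms by (simp_all add: unitary_matrix_def)
  then show ?thesis
    by (simp add: unitary_matrix_def adjoint_matrix_mult matrix_mul_assoc)
qed

section \<open>The automaton\<close>

locale mod_automaton =
  fixes n0 n1 n2 ac rj rs :: "'q::finite" and \<theta> \<phi> :: real
  assumes distinct: "distinct [n0, n1, n2, ac, rj, rs]"
begin

text \<open>Gives the simplifier the disequalities in the opposite orientation.\<close>

lemma distinct': "distinct [rs, rj, ac, n2, n1, n0]"
  using distinct by auto

text \<open>The right end-marker makes quarter turns in three disjoint planes, a unitary completion
  of moving \<open>n0\<close>, \<open>n1\<close>, \<open>n2\<close> to \<open>rs\<close>,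
  \<open>rj\<close>, \<open>ac\<close>.\<close>

fun unitary :: "letter tape_symbol \<Rightarrow> complex^'q^'q" where
  "unitary LeftEnd = plane_rotation n0 n2 \<theta>"
| "unitary (Input _) = plane_rotation n0 n1 \<phi>"
| "unitary RightEnd =
    plane_rotation n0 rs (pi / 2) ** plane_rotation n1 rj (pi / 2) ** plane_rotation n2 ac (pi / 2)"

text \<open>The complement makes the four sets cover the whole type: every unnamed state is
  restarting along with \<open>rs\<close>, and no amplitude reaches it during a round.\<close>

definition automaton :: "('q, letter) rqfa" where
  "automaton = \<lparr>q_non = {n0, n1, n2}, q_acc = {ac}, q_rej = {rj},
     q_restart = - {n0, n1, n2, ac, rj}, q_init = n0, transition = unitary\<rparr>"

lemma automaton_sel [simp]:
  "q_non automaton = {n0, n1, n2}" "q_acc automaton = {ac}" "q_rej automaton = {rj}"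
  "q_restart automaton = - {n0, n1, n2, ac, rj}" "q_init automaton = n0"
  "transition automaton = unitary"
  by (simp_all add: automaton_def)

text \<open>The shape of all vectors in a round: supported on \<open>n0\<close>, \<open>n1\<close>,
  \<open>n2\<close> until the right end-marker is read, on \<open>rs\<close>, \<open>rj\<close>,
  \<open>ac\<close> afterwards, with real amplitudes.\<close>

definition vec3 :: "'q \<Rightarrow> 'q \<Rightarrow> 'q \<Rightarrow> real \<Rightarrow> real \<Rightarrow> real \<Rightarrow> complex^'q" where
  "vec3 p q s x y z = (\<chi> i. if i = p then of_real x else if i = q then of_real y
     else if i = s then of_real z else 0)"

lemma norm_span_proj:
  "(norm (span_proj S v))\<^sup>2 = (\<Sum>i\<in>S. (cmod (v $ i))\<^sup>2)" for v :: "complex^'q"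
proof -
  have "(norm (span_proj S v))\<^sup>2 = (\<Sum>i\<in>UNIV. if i \<in> S then (cmod (v $ i))\<^sup>2 else 0)"
    by (simp add: norm_vec_def L2_set_def sum_nonneg) (intro sum.cong, auto simp: span_proj_def)
  then show ?thesis by (simp add: sum.If_cases)
qed

lemma sum_restart_vec3:
  "(\<Sum>i\<in>- {n0, n1, n2, ac, rj}. (cmod (vec3 rs rj ac x y z $ i))\<^sup>2) = x\<^sup>2"
proof -
  have "(\<Sum>i\<in>- {n0, n1, n2, ac, rj}. (cmod (vec3 rs rj ac x y z $ i))\<^sup>2)
    = (\<Sum>i\<in>{rs}. (cmod (vec3 rs rj ac x y z $ i))\<^sup>2)"
    using distinct distinct' by (intro sum.mono_neutral_right) (auto simp: vec3_def)
  then show ?thesis by (simp add: vec3_def)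
qed

lemma measurement_vec3_non:
  assumes "x\<^sup>2 + y\<^sup>2 + z\<^sup>2 = 1"
  shows "measurement automaton (vec3 n0 n1 n2 x y z) = return_pmf Nonhalt"
    and "sgn (span_proj {n0, n1, n2} (vec3 n0 n1 n2 x y z)) = vec3 n0 n1 n2 x y z"
proof -
  let ?v = "vec3 n0 n1 n2 x y z"
  have proj: "span_proj {n0, n1, n2} ?v = ?v"
    by (auto simp: span_proj_def vec3_def vec_eq_iff)
  have non: "(norm (span_proj {n0, n1, n2} ?v))\<^sup>2 = 1"
    using distinct distinct' assms by (simp add: norm_span_proj vec3_def add.assoc)
  have other: "(norm (span_proj (outcome_states automaton u) ?v))\<^sup>2 = (if u = Nonhalt then 1 else 0)"
    for u
    using non distinct distinct' by (cases u) (auto simp: norm_span_proj vec3_def intro!: sum.neutral)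
  have "pmf (measurement automaton ?v) u = (if u = Nonhalt then 1 else 0)" for u
    by (subst pmf_measurement) (simp_all only: other, simp add: UNIV_outcome)
  then show "measurement automaton ?v = return_pmf Nonhalt"
    by (intro pmf_eqI) (simp add: indicator_def)
  have "norm ?v = 1" using non proj norm_ge_zero[of ?v] by (auto simp: power2_eq_1_iff)
  then show "sgn (span_proj {n0, n1, n2} ?v) = ?v"
    using proj by (simp add: sgn_div_norm)
qed

lemma measurement_vec3_end:
  assumes "x\<^sup>2 + y\<^sup>2 + z\<^sup>2 = 1"
  shows "pmf (measurement automaton (vec3 rs rj ac x y z)) Nonhalt = 0"
    and "pmf (measurement automaton (vec3 rs rj ac x y z)) Accept = z\<^sup>2"
    and "pmf (measurement automaton (vec3 rs rj ac x y z)) Reject = y\<^sup>2"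
proof -
  let ?v = "vec3 rs rj ac x y z"
  have weights: "(norm (span_proj (outcome_states automaton Nonhalt) ?v))\<^sup>2 = 0"
    "(norm (span_proj (outcome_states automaton Accept) ?v))\<^sup>2 = z\<^sup>2"
    "(norm (span_proj (outcome_states automaton Reject) ?v))\<^sup>2 = y\<^sup>2"
    "(norm (span_proj (outcome_states automaton Restart) ?v))\<^sup>2 = x\<^sup>2"
    using distinct distinct' sum_restart_vec3 by (simp_all only: norm_span_proj) (auto simp: vec3_def)
  have "(\<Sum>u\<in>UNIV. (norm (span_proj (outcome_states automaton u) ?v))\<^sup>2) = 1"
    unfolding UNIV_outcome using assms by (simp add: weights del: outcome_states.simps)
  note pmf_measurement[OF this]
  then show "pmf (measurement automaton ?v) Nonhalt = 0" "pmf (measurement automaton ?v) Accept = z\<^sup>2"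
    "pmf (measurement automaton ?v) Reject = y\<^sup>2"
    by (simp_all only: weights)
qed

section \<open>Effect of the transitions on the amplitudes\<close>

lemma unitary_LeftEnd: "unitary LeftEnd *v vec3 n0 n1 n2 1 0 0 = vec3 n0 n1 n2 (cos \<theta>) 0 (sin \<theta>)"
  using distinct distinct' by (simp add: plane_rotation_mult_vec vec3_def vec_eq_iff)

text \<open>In polar form, a letter adds \<phi> to the angle in the plane of \<open>n0\<close> and
  \<open>n1\<close>; the radius \<open>c\<close> and the third amplitude stay.\<close>

lemma unitary_Input:
  "unitary (Input l) *v vec3 n0 n1 n2 (c * cos t) (c * sin t) z
    = vec3 n0 n1 n2 (c * cos (t + \<phi>)) (c * sin (t + \<phi>)) z"
  using distinct distinct'
  by (simp add: plane_rotation_mult_vec vec3_def vec_eq_iff cos_add sin_add algebra_simps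
    del: sin_of_real cos_of_real)

lemma unitary_RightEnd: "unitary RightEnd *v vec3 n0 n1 n2 x y z = vec3 rs rj ac x y z"
  using distinct distinct'
  by (simp add: plane_rotation_mult_vec vec3_def vec_eq_iff flip: matrix_vector_mul_assoc)

lemma unitary_matrix_unitary: "unitary_matrix (unitary s)"
  using distinct distinct' by (cases s) (auto intro!: unitary_matrix_mult unitary_plane_rotation)

text \<open>Index \<open>Suc j\<close> is the vector after the left end-marker and \<open>j\<close>
  letters, hence the angle \<open>j * \<phi>\<close>.\<close>

fun round_state :: "nat \<Rightarrow> complex^'q" where
  "round_state 0 = vec3 n0 n1 n2 1 0 0"
| "round_state (Suc j) =
    vec3 n0 n1 n2 (cos \<theta> * cos (real j * \<phi>)) (cos \<theta> * sin (real j * \<phi>)) (sin \<theta>)"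

lemma unit_amplitudes: "(cos \<theta> * cos t)\<^sup>2 + (cos \<theta> * sin t)\<^sup>2 + (sin \<theta>)\<^sup>2 = 1"
  by (simp add: power_mult_distrib flip: distrib_left)

lemma unitary_round_state:
  assumes "j \<le> length w"
  shows "unitary (tape w ! j) *v round_state j = round_state (Suc j)"
proof (cases j)
  case 0
  then show ?thesis using unitary_LeftEnd by (simp add: tape_def del: unitary.simps)
next
  case (Suc i)
  then have "tape w ! j = Input (w ! i)" using assms by (simp add: tape_def nth_append)
  then show ?thesis
    using Suc unitary_Input[of _ "cos \<theta>" "real i * \<phi>"] by (simp add: algebra_simps del: unitary.simps)
qed

lemma round:
  assumes "sin \<theta> \<noteq> 0"
  shows "measurement_free_round automaton w round_state ((sin \<theta>)\<^sup>2)
    ((cos \<theta> * sin (real (length w) * \<phi>))\<^sup>2)"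
proof
  show "round_state 0 = axis (q_init automaton) 1"
    by (auto simp: vec3_def axis_def vec_eq_iff)
next
  fix j assume j: "j \<le> length w"
  show "measurement automaton (transition automaton (tape w ! j) *v round_state j) = return_pmf Nonhalt"
    "sgn (span_proj (q_non automaton) (transition automaton (tape w ! j) *v round_state j))
      = round_state (Suc j)"
    using measurement_vec3_non[OF unit_amplitudes]
    by (simp_all add: unitary_round_state[OF j])
next
  show "(sin \<theta>)\<^sup>2 + (cos \<theta> * sin (real (length w) * \<phi>))\<^sup>2 > 0"
    using assms by (simp add: add_pos_nonneg)
qed (simp_all only: automaton_sel round_state.simps unitary_RightEnd
    measurement_vec3_end[OF unit_amplitudes])

lemma is_rqfa_automaton:
  assumes "sin \<theta> \<noteq> 0"
  shows "is_rqfa automaton"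
  unfolding is_rqfa_def
proof (intro conjI allI impI)
  show "rqfa_states automaton = UNIV" by (auto simp: rqfa_states_def)
  show "outcome_states automaton x \<inter> outcome_states automaton y = {}" if "x \<noteq> y" for x y
    using that distinct distinct' by (cases x; cases y) auto
  show "q_init automaton \<in> q_non automaton" by simp
  show "unitary_matrix (transition automaton s)" for s by (simp add: unitary_matrix_unitary)
  show "(Running v [], t) \<notin> set_pmf (run automaton w k)" for w k v t
    by (rule measurement_free_round.no_survivor[OF round[OF assms]])
qed

end

section \<open>The choice of the angles\<close>

lemma mem_B_iff: "w \<in> B m \<longleftrightarrow> m dvd length w"
proof -
  have "w = replicate (length w) Letter_a"
    by (metis letter.exhaust replicate_length_same)
  then show ?thesis unfolding B_def by (auto simp: cong_0_iff)
qed

text \<open>The squared sine has period \<open>pi\<close>, so \<open>n\<close> may be replaced by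
  its residue modulo \<open>m\<close>, which is nonzero. The angle then lies between
  \<open>pi / m\<close> and \<open>pi - pi / m\<close>, where the sine is smallest at the
  endpoints.\<close>

lemma sin_multiple_ge:
  assumes "m \<ge> 2" "\<not> m dvd n"
  shows "(sin (real n * (pi / real m)))\<^sup>2 \<ge> (sin (pi / real m))\<^sup>2"
proof -
  define k where "k = n mod m"
  have k: "1 \<le> k" "k \<le> m - 1" using assms by (auto simp: k_def dvd_eq_mod_eq_0 Suc_le_eq less_Suc_eq_le[symmetric])
  define x where "x = real k * (pi / real m)"
  have "real n = real (n div m) * real m + real k"
    by (simp add: k_def flip: of_nat_mult of_nat_add)
  then have "real n * (pi / real m) = x + real (n div m) * pi"
    using assms(1) by (simp add: x_def field_simps)
  then have "(sin (real n * (pi / real m)))\<^sup>2 = (sin x)\<^sup>2"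
    by (simp add: sin_add power_mult_distrib flip: power_mult)
  moreover have "(sin (pi / real m))\<^sup>2 \<le> (sin x)\<^sup>2"
  proof (rule power_mono)
    have pim: "0 < pi / real m" "pi / real m \<le> pi / 2"
      using assms(1) by (auto simp: field_simps)
    have lo: "pi / real m \<le> x"
      using mult_right_mono[of 1 "real k" "pi / real m"] k pim by (simp add: x_def)
    have "x \<le> (real m - 1) * (pi / real m)"
      unfolding x_def using k assms(1) pim by (intro mult_right_mono) (simp_all add: le_diff_conv2)
    then have hi: "pi / real m \<le> pi - x" using assms(1) by (simp add: field_simps)
    show "sin (pi / real m) \<le> sin x"
    proof (cases "x \<le> pi / 2")
      case True
      then show ?thesis using lo pim by (intro sin_monotone_2pi_le) auto
    next
      case False
      then have "sin (pi / real m) \<le> sin (pi - x)"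
        using hi pim by (intro sin_monotone_2pi_le) auto
      then show ?thesis by simp
    qed
    show "0 \<le> sin (pi / real m)" using pim pi_gt_zero by (intro sin_ge_zero) linarith+
  qed
  ultimately show ?thesis by simp
qed

theorem theorem17:
  shows "\<exists>C::real. C > 0 \<and> (\<forall>m::nat. m \<ge> 2 \<longrightarrow> (\<forall>\<epsilon>::real. \<epsilon> > 0 \<longrightarrow>
    (\<exists>M :: (7, letter) rqfa.
       is_rqfa M \<and>
       card (rqfa_states M) = 7 \<and>
       (\<forall>w. w \<in> B m \<longrightarrow> accept_prob M w = 1) \<and>
       (\<forall>w. w \<notin> B m \<longrightarrow> reject_prob M w \<ge> 1 - \<epsilon>) \<and>
       (\<forall>w. w \<noteq> [] \<longrightarrow>
          expected_runtime M w \<le>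
            ennreal (C * (1 / min 1 \<epsilon>) * (1 / (sin (pi / real m))\<^sup>2) * real (length w))))))"
proof (intro exI[of _ 6] conjI allI impI)
  fix m :: nat and \<epsilon> :: real
  assume m: "m \<ge> 2" and "\<epsilon> > 0"
  define e where "e = min 1 \<epsilon>"
  define S where "S = (sin (pi / real m))\<^sup>2"
  \<comment> \<open>Off \<open>B m\<close> the rejection probability of a round is at least
    \<open>(1 - a) * S \<ge> S / 2\<close>, so \<open>a\<close> is at most \<open>e\<close> times
    it.\<close>
  define a where "a = e * S / 2"
  define \<theta> where "\<theta> = arcsin (sqrt a)"
  have e: "0 < e" "e \<le> 1" "e \<le> \<epsilon>" using \<open>\<epsilon> > 0\<close> by (auto simp: e_def)
  have "sin (pi / real m) > 0" using m by (intro sin_gt_zero) (auto simp: field_simps)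
  then have S: "0 < S" "S \<le> 1" by (simp_all add: S_def abs_square_le_1)
  have eS: "e * S \<le> 1" using e S by (simp add: mult_le_one)
  have a: "0 < a" "a \<le> 1 / 2" using e S eS by (auto simp: a_def)
  have sin_\<theta>: "(sin \<theta>)\<^sup>2 = a" "sin \<theta> \<noteq> 0" 
  proof -
    have "sin \<theta> = sqrt a"
      unfolding \<theta>_def using a by (intro sin_arcsin) (auto intro: order_trans[of _ 0])
    then show "(sin \<theta>)\<^sup>2 = a" "sin \<theta> \<noteq> 0" using a by auto
  qed
  have cos_\<theta>: "(cos \<theta>)\<^sup>2 = 1 - a" by (simp add: cos_squared_eq sin_\<theta>)
  \<comment> \<open>Six of the seven elements are named; the remaining one becomes a second
    restarting state.\<close>
  interpret mod_automaton "0::7" 1 2 3 4 5 \<theta> "pi / real m"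
    by unfold_locales simp
  define r where "r n = (1 - a) * (sin (real n * (pi / real m)))\<^sup>2" for n
  have round_w: "measurement_free_round automaton w round_state a (r (length w))" for w
    using round[OF sin_\<theta>(2), of w] by (simp add: sin_\<theta> cos_\<theta> r_def power_mult_distrib)
  have r_nonneg: "r n \<ge> 0" for n using a by (simp add: r_def)
  show "\<exists>M :: (7, letter) rqfa. is_rqfa M \<and> card (rqfa_states M) = 7 \<and>
       (\<forall>w. w \<in> B m \<longrightarrow> accept_prob M w = 1) \<and>
       (\<forall>w. w \<notin> B m \<longrightarrow> reject_prob M w \<ge> 1 - \<epsilon>) \<and>
       (\<forall>w. w \<noteq> [] \<longrightarrow>
          expected_runtime M w \<le>
            ennreal (6 * (1 / min 1 \<epsilon>) * (1 / (sin (pi / real m))\<^sup>2) * real (length w)))"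
  proof (intro exI[of _ automaton] conjI allI impI)
    show M: "is_rqfa automaton" by (rule is_rqfa_automaton[OF sin_\<theta>(2)])
    show "card (rqfa_states automaton) = 7" using M by (simp add: is_rqfa_def)
  next
    fix w assume "w \<in> B m"
    then obtain l where "length w = m * l" by (auto simp: mem_B_iff)
    \<comment> \<open>The plane has made whole half turns, so the rejecting amplitude vanishes and
      the bound \<open>a / (a + r)\<close> is 1.\<close>
    then have "real (length w) * (pi / real m) = real l * pi" using m by simp
    then have "r (length w) = 0" by (simp add: r_def)
    then show "accept_prob automaton w = 1"
      using measurement_free_round.accept_prob_ge[OF round_w, of w] a accept_prob_le_1[of automaton w]
      by simp
  next
    fix w assume "w \<notin> B m"
    then have "S \<le> (sin (real (length w) * (pi / real m)))\<^sup>2"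
      unfolding S_def by (intro sin_multiple_ge[OF m]) (simp add: mem_B_iff)
    then have "1 / 2 * S \<le> r (length w)"
      unfolding r_def using a S by (intro mult_mono) auto
    then have "a \<le> e * r (length w)"
      using mult_left_mono[of "1 / 2 * S" "r (length w)" e] e by (simp add: a_def)
    also have "\<dots> \<le> \<epsilon> * r (length w)" using e r_nonneg by (intro mult_right_mono)
    also have "\<dots> \<le> \<epsilon> * (a + r (length w))" using \<open>\<epsilon> > 0\<close> a by (intro mult_left_mono) auto
    \<comment> \<open>The right side is \<open>1 - a / (a + r)\<close>, and
      \<open>a \<le> \<epsilon> * (a + r)\<close> was just shown.\<close>
    finally have "1 - \<epsilon> \<le> r (length w) / (a + r (length w))"
      using a r_nonneg[of "length w"] by (simp add: field_simps)
    then show "reject_prob automaton w \<ge> 1 - \<epsilon>"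
      using measurement_free_round.reject_prob_ge[OF round_w, of w] by linarith
  next
    fix w :: "letter list" assume "w \<noteq> []"
    then have "length w \<ge> 1" by (simp add: Suc_le_eq)
    \<comment> \<open>For a nonempty word \<open>length w + 2 \<le> 3 * length w\<close>; this 3 and
      the 2 in the denominator of \<open>a\<close> make the constant 6.\<close>
    then have "(real (length w) + 2) / (a + r (length w)) \<le> 3 * real (length w) / a"
      using a r_nonneg[of "length w"] by (intro frac_le) auto
    also have "\<dots> = 6 * (1 / e) * (1 / S) * real (length w)"
      by (simp add: a_def)
    finally show "expected_runtime automaton w \<le>
        ennreal (6 * (1 / min 1 \<epsilon>) * (1 / (sin (pi / real m))\<^sup>2) * real (length w))"
      unfolding e_def S_def
      by (intro order_trans[OF measurement_free_round.expected_runtime_le[OF round_w]] ennreal_leI)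
  qed
qed simp

end
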